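(* Let $\kappa>1$. There exists a $\beta$-smooth and $\alpha$-strongly convex function $f:\ell_2\to\mathbb{R}$ with $\kappa=\beta/\alpha$, with minimizer $x^*$, such that for any $t\ge 1$ and any black-box procedure satisfying the span condition one has $$f(x_t)-f(x^* )\ge\frac\alpha2\left(\frac{\sqrt\kappa-1}{\sqrt\kappa+1}\right)^{2(t-1)}\|x_1-x^*\|^2.$$
   Context: $\ell_2$ is the Hilbert space of real square-summable sequences with its usual norm $\|\cdot\|$ and inner product $\langle\cdot,\cdot\rangle$. $f$ is $\beta$-smooth if it is continuously (Fréchet) differentiable with $\|\nabla f(x)-\nabla f(y)\|\le\beta\|x-y\|$, and $\alpha$-strongly convex ($\alpha>0$) if $f(x)-f(y)\le\langle\nabla f(x),x-y\rangle-\frac\alpha2\|x-y\|^2$, for all $x,y\in\ell_2$. A black-box procedure maps the history $(x_1,g_1,\dots,x_s,g_s)$, where $g_j=\nabla f(x_j)$, to the next query point $x_{s+1}\in\ell_2$. The span condition is: $x_1=0$ and $x_{s+1}\in\mathrm{Span}(g_1,\dots,g_s)$ for every $s\ge 1$. *)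

theory Defs
  imports "HOL-Analysis.Analysis"
begin

section \<open>The Hilbert space of real square-summable sequences\<close>

typedef ell2 = "{x :: nat \<Rightarrow> real. summable (\<lambda>n. (x n)\<^sup>2)}"
  morphisms ell2_nth Abs_ell2
  by (rule exI[of _ "\<lambda>_. 0"]) simp

setup_lifting type_definition_ell2

lemma summable_ell2_mult:
  fixes x y :: "nat \<Rightarrow> real"
  assumes "summable (\<lambda>n. (x n)\<^sup>2)" "summable (\<lambda>n. (y n)\<^sup>2)"
  shows "summable (\<lambda>n. x n * y n)"
proof (rule summable_comparison_test')
  show "summable (\<lambda>n. (x n)\<^sup>2 + (y n)\<^sup>2)"
    using assms by (rule summable_add)
next
  fix n :: nat
  have "2 * \<bar>x n\<bar> * \<bar>y n\<bar> \<le> \<bar>x n\<bar>\<^sup>2 + \<bar>y n\<bar>\<^sup>2"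
    by (rule sum_squares_bound)
  then have "2 * \<bar>x n * y n\<bar> \<le> (x n)\<^sup>2 + (y n)\<^sup>2"
    by (simp add: abs_mult mult.assoc)
  then show "norm (x n * y n) \<le> (x n)\<^sup>2 + (y n)\<^sup>2"
    unfolding real_norm_def using abs_ge_zero[of "x n * y n"] by linarith
qed

lemma summable_ell2_add:
  fixes x y :: "nat \<Rightarrow> real"
  assumes "summable (\<lambda>n. (x n)\<^sup>2)" "summable (\<lambda>n. (y n)\<^sup>2)"
  shows "summable (\<lambda>n. (x n + y n)\<^sup>2)"
proof -
  have "summable (\<lambda>n. (x n)\<^sup>2 + (y n)\<^sup>2 + 2 * (x n * y n))"
    by (intro summable_add summable_mult assms summable_ell2_mult)
  then show ?thesis
    by (simp add: power2_sum mult.assoc)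
qed

lemma summable_ell2_scale:
  fixes x :: "nat \<Rightarrow> real"
  assumes "summable (\<lambda>n. (x n)\<^sup>2)"
  shows "summable (\<lambda>n. (c * x n)\<^sup>2)"
  using summable_mult[OF assms, of "c\<^sup>2"] by (simp add: power_mult_distrib)

instantiation ell2 :: real_vector
begin

lift_definition zero_ell2 :: ell2 is "\<lambda>_. 0" by simp

lift_definition plus_ell2 :: "ell2 \<Rightarrow> ell2 \<Rightarrow> ell2" is "\<lambda>x y n. x n + y n"
  by (rule summable_ell2_add)

lift_definition scaleR_ell2 :: "real \<Rightarrow> ell2 \<Rightarrow> ell2" is "\<lambda>c x n. c * x n"
  by (rule summable_ell2_scale)

lift_definition uminus_ell2 :: "ell2 \<Rightarrow> ell2" is "\<lambda>x n. - x n"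
  by simp

lift_definition minus_ell2 :: "ell2 \<Rightarrow> ell2 \<Rightarrow> ell2" is "\<lambda>x y n. x n - y n"
proof -
  fix x y :: "nat \<Rightarrow> real"
  assume "summable (\<lambda>n. (x n)\<^sup>2)" "summable (\<lambda>n. (y n)\<^sup>2)"
  then show "summable (\<lambda>n. (x n - y n)\<^sup>2)"
    using summable_ell2_add[of x "\<lambda>n. - y n"] by simp
qed

instance
  by standard (transfer; simp add: algebra_simps fun_eq_iff)+

end

instantiation ell2 :: real_inner
begin

lift_definition inner_ell2 :: "ell2 \<Rightarrow> ell2 \<Rightarrow> real" is "\<lambda>x y. \<Sum>n. x n * y n" .

definition norm_ell2 :: "ell2 \<Rightarrow> real" where
  "norm_ell2 x = sqrt (inner x x)"

definition dist_ell2 :: "ell2 \<Rightarrow> ell2 \<Rightarrow> real" where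
  "dist_ell2 x y = norm (x - y)"

definition sgn_ell2 :: "ell2 \<Rightarrow> ell2" where
  "sgn_ell2 x = x /\<^sub>R norm x"

definition uniformity_ell2 :: "(ell2 \<times> ell2) filter" where
  "uniformity_ell2 = (INF e\<in>{0<..}. principal {(x, y). dist x y < e})"

definition open_ell2 :: "ell2 set \<Rightarrow> bool" where
  "open_ell2 U = (\<forall>x\<in>U. eventually (\<lambda>(x', y). x' = x \<longrightarrow> y \<in> U) uniformity)"

instance
proof
  fix x y z :: ell2 and r :: real and U :: "ell2 set"
  show "dist x y = norm (x - y)"
    by (rule dist_ell2_def)
  show "sgn x = x /\<^sub>R norm x"
    by (rule sgn_ell2_def)
  show "(uniformity :: (ell2 \<times> ell2) filter) = (INF e\<in>{0<..}. principal {(x, y). dist x y < e})"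
    by (rule uniformity_ell2_def)
  show "open U = (\<forall>x\<in>U. eventually (\<lambda>(x', y). x' = x \<longrightarrow> y \<in> U) uniformity)"
    by (rule open_ell2_def)
  show "inner x y = inner y x"
    by transfer (simp add: mult.commute)
  show "inner (x + y) z = inner x z + inner y z"
    by transfer (simp add: distrib_right suminf_add summable_ell2_mult)
  show "inner (r *\<^sub>R x) y = r * inner x y"
    by transfer (simp add: mult.assoc suminf_mult summable_ell2_mult)
  show "0 \<le> inner x x"
    by transfer (simp add: suminf_nonneg power2_eq_square)
  show "inner x x = 0 \<longleftrightarrow> x = 0"
  proof transfer
    fix x :: "nat \<Rightarrow> real"
    assume "summable (\<lambda>n. (x n)\<^sup>2)"
    then have "(\<Sum>n. x n * x n) = 0 \<longleftrightarrow> (\<forall>n. x n * x n = 0)"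
      by (intro suminf_eq_zero_iff) (simp_all add: power2_eq_square)
    then show "(\<Sum>n. x n * x n) = 0 \<longleftrightarrow> x = (\<lambda>_. 0)"
      by (simp add: fun_eq_iff)
  qed
  show "norm x = sqrt (inner x x)"
    by (rule norm_ell2_def)
qed

end

section \<open>Smoothness and strong convexity\<close>

definition grad :: "('a::real_inner \<Rightarrow> real) \<Rightarrow> 'a \<Rightarrow> 'a" where
  "grad f x = (THE D. GDERIV f x :> D)"

lemma grad_eqI: "GDERIV f x :> D \<Longrightarrow> grad f x = D"
  unfolding grad_def
proof (rule the_equality)
  fix E
  assume "GDERIV f x :> D" "GDERIV f x :> E"
  then have "(\<lambda>h. inner h D) = (\<lambda>h. inner h E)"
    unfolding gderiv_def by (rule has_derivative_unique)
  then have "inner (E - D) D = inner (E - D) E"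
    by (rule fun_cong)
  then show "E = D"
    by (metis eq_iff_diff_eq_0 inner_diff_right inner_eq_zero_iff)
qed

text \<open>
  A gradient at \<open>x\<close> represents the Frechet derivative at \<open>x\<close>, and this correspondence is isometric,
  so continuity of the gradient is continuity of the Frechet derivative in operator norm.
\<close>

definition smooth_fun :: "real \<Rightarrow> ('a::real_inner \<Rightarrow> real) \<Rightarrow> bool" where
  "smooth_fun \<beta> f \<longleftrightarrow>
     (\<forall>x. GDERIV f x :> grad f x) \<and>
     continuous_on UNIV (grad f) \<and>
     (\<forall>x y. norm (grad f x - grad f y) \<le> \<beta> * norm (x - y))"

definition strongly_convex_fun :: "real \<Rightarrow> ('a::real_inner \<Rightarrow> real) \<Rightarrow> bool" where
  "strongly_convex_fun \<alpha> f \<longleftrightarrow>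
     \<alpha> > 0 \<and>
     (\<forall>x y. f x - f y \<le> inner (grad f x) (x - y) - \<alpha> / 2 * (norm (x - y))\<^sup>2)"

section \<open>Black-box procedures\<close>

text \<open>
  A procedure maps the list \<open>[(x\<^sub>1, g\<^sub>1), \<dots>, (x\<^sub>s, g\<^sub>s)]\<close> (oldest entry first) to \<open>x\<^sub>s\<^sub>+\<^sub>1\<close>;
  its value on the empty list is the first query point \<open>x\<^sub>1\<close>.
\<close>

type_synonym 'a black_box = "('a \<times> 'a) list \<Rightarrow> 'a"

primrec history :: "'a::real_inner black_box \<Rightarrow> ('a \<Rightarrow> real) \<Rightarrow> nat \<Rightarrow> ('a \<times> 'a) list" where
  "history A f 0 = []"
| "history A f (Suc s) =
     (let h = history A f s; x = A h in h @ [(x, grad f x)])"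

text \<open>Query points are numbered from 1; \<open>query A f 0\<close> has no meaning and is never used.\<close>

definition query :: "'a::real_inner black_box \<Rightarrow> ('a \<Rightarrow> real) \<Rightarrow> nat \<Rightarrow> 'a" where
  "query A f s = A (history A f (s - 1))"

definition span_condition :: "'a::real_inner black_box \<Rightarrow> ('a \<Rightarrow> real) \<Rightarrow> bool" where
  "span_condition A f \<longleftrightarrow>
     query A f 1 = 0 \<and>
     (\<forall>s\<ge>1. query A f (s + 1) \<in> span ((\<lambda>j. grad f (query A f j)) ` {1..s}))"

end

theory Submission
  imports Defs
begin

text \<open>
  The witness is Nesterov's quadratic function
  \<open>f x = \<langle>M x, x\<rangle> / 2 - c \<langle>e\<^sub>0, x\<rangle>\<close> with \<open>M = \<alpha> I + c (2 I - S - L)\<close>, where \<open>S\<close> and \<open>L\<close> are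
  the right and left shifts and \<open>4 c = \<beta> - \<alpha>\<close>.  In coordinates \<open>M\<close> is tridiagonal.

  The shifts are adjoint to each other and are contractions.  Hence \<open>M\<close> is symmetric and
  \<open>\<alpha> \<parallel>h\<parallel>\<^sup>2 \<le> \<langle>M h, h\<rangle>\<close>, \<open>\<parallel>M h\<parallel> \<le> (\<alpha> + 4 c) \<parallel>h\<parallel> = \<beta> \<parallel>h\<parallel>\<close>, which gives strong convexity and smoothness.
  The equation \<open>M x = c e\<^sub>0\<close> for a critical point is a linear recurrence whose square-summable
  solution is the geometric sequence \<open>x\<^sup>* = (q, q\<^sup>2, q\<^sup>3, \<dots>)\<close> with
  \<open>q = (sqrt \<kappa> - 1) / (sqrt \<kappa> + 1)\<close>, the root in \<open>(0, 1)\<close> of the characteristic equation.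

  Every gradient extends the support of its argument by at most one coordinate, because \<open>M\<close> is
  tridiagonal.  Under the span condition the point \<open>x\<^sub>t\<close> therefore vanishes from coordinate
  \<open>t - 1\<close> (counted from \<open>0\<close>) onwards (\<open>query_vanishes_from\<close>).
  Now \<open>L\<close> is a contraction with \<open>L x\<^sup>* = q x\<^sup>*\<close>, and \<open>L ^^ (t - 1)\<close> annihilates
  \<open>x\<^sub>t\<close>; so \<open>\<parallel>x\<^sub>t - x\<^sup>*\<parallel> \<ge> q ^ (t - 1) \<parallel>x\<^sup>*\<parallel>\<close> (\<open>geometric_tail_bound\<close>).  Strong
  convexity at \<open>x\<^sup>*\<close> turns this distance into the required gap in function value.
\<close>

section \<open>Shifts on the sequence space\<close>

lift_definition unit0 :: ell2 is "\<lambda>n. if n = 0 then 1 else 0"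
  by (rule summable_finite[of "{0}"]) auto

lift_definition shiftL :: "ell2 \<Rightarrow> ell2" is "\<lambda>x n. x (Suc n)"
  by (simp add: summable_Suc_iff[where f = "\<lambda>n. (_ n)\<^sup>2"])

lift_definition shiftR :: "ell2 \<Rightarrow> ell2" is "\<lambda>x n. case n of 0 \<Rightarrow> 0 | Suc m \<Rightarrow> x m"
  by (subst summable_Suc_iff[symmetric]) simp

text \<open>
  Outside the range \<open>\<bar>q\<bar> < 1\<close>, where the sequence fails to be square-summable, the value is \<open>0\<close>.
\<close>

lift_definition geometric :: "real \<Rightarrow> ell2" is "\<lambda>q n. if \<bar>q\<bar> < 1 then q ^ Suc n else 0"
proof -
  fix q :: real
  have "summable (\<lambda>n. (q ^ Suc n)\<^sup>2)" if "\<bar>q\<bar> < 1"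
  proof -
    have "summable (\<lambda>n. q\<^sup>2 * (q\<^sup>2) ^ n)"
      using that by (intro summable_mult summable_geometric) (simp add: abs_square_less_1)
    then show ?thesis
      by (simp add: power_mult_distrib power_mult[symmetric] mult.commute)
  qed
  then show "summable (\<lambda>n. (if \<bar>q\<bar> < 1 then q ^ Suc n else 0)\<^sup>2)"
    by (cases "\<bar>q\<bar> < 1") (simp_all del: power_Suc)
qed

lemma ell2_eqI: "(\<And>n. ell2_nth x n = ell2_nth y n) \<Longrightarrow> x = y"
  by (simp add: ell2_nth_inject[symmetric] fun_eq_iff)

lemmas ell2_nth_simps =
  zero_ell2.rep_eq plus_ell2.rep_eq minus_ell2.rep_eq uminus_ell2.rep_eq scaleR_ell2.rep_eq
  unit0.rep_eq shiftL.rep_eq shiftR.rep_eq geometric.rep_eq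

lemma linear_shiftL: "linear shiftL"
  by (rule linearI; rule ell2_eqI; simp add: ell2_nth_simps)

lemma linear_shiftR: "linear shiftR"
  by (rule linearI; rule ell2_eqI; simp add: ell2_nth_simps split: nat.split)

lemma shiftL_shiftR [simp]: "shiftL (shiftR x) = x"
  by (rule ell2_eqI) (simp add: ell2_nth_simps)

lemma inner_shiftR_left: "inner (shiftR x) y = inner x (shiftL y)"
proof transfer
  fix x y :: "nat \<Rightarrow> real"
  assume x: "summable (\<lambda>n. (x n)\<^sup>2)" and y: "summable (\<lambda>n. (y n)\<^sup>2)"
  let ?p = "\<lambda>n. (case n of 0 \<Rightarrow> 0 | Suc m \<Rightarrow> x m) * y n"
  have "summable (\<lambda>n. x n * y (Suc n))"
    using x y by (intro summable_ell2_mult) (simp_all add: summable_Suc_iff[where f = "\<lambda>n. (y n)\<^sup>2"])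
  then have "summable ?p"
    by (subst summable_Suc_iff[symmetric]) simp
  from suminf_split_head[OF this] show "(\<Sum>n. ?p n) = (\<Sum>n. x n * y (Suc n))"
    by simp
qed

lemma inner_shiftL_left: "inner (shiftL x) y = inner x (shiftR y)"
  by (metis inner_commute inner_shiftR_left)

lemma norm_shiftR [simp]: "norm (shiftR x) = norm x"
  by (simp add: norm_eq_sqrt_inner inner_shiftR_left)

text \<open>
  The left shift is the adjoint of the isometry \<open>shiftR\<close>; an adjoint has the same operator norm.
\<close>

lemma norm_shiftL_le: "norm (shiftL x) \<le> norm x"
proof -
  have "(norm (shiftL x))\<^sup>2 = inner x (shiftR (shiftL x))"
    by (simp add: power2_norm_eq_inner inner_shiftL_left)
  also have "\<dots> \<le> norm x * norm (shiftL x)"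
    using norm_cauchy_schwarz[of x "shiftR (shiftL x)"] by simp
  finally show ?thesis
    by (cases "norm (shiftL x) = 0") (simp_all add: power2_eq_square)
qed

lemma norm_funpow_shiftL_le: "norm ((shiftL ^^ k) x) \<le> norm x"
  by (induction k) (auto intro: order_trans[OF norm_shiftL_le])

lemma ell2_nth_funpow_shiftL: "ell2_nth ((shiftL ^^ k) x) n = ell2_nth x (n + k)"
  by (induction k arbitrary: n) (simp_all add: shiftL.rep_eq)

section \<open>Sequences of finite support\<close>

definition vanishes_from :: "nat \<Rightarrow> ell2 set" where
  "vanishes_from k = {x. \<forall>n\<ge>k. ell2_nth x n = 0}"

lemma subspace_vanishes_from: "subspace (vanishes_from k)"
  by (rule subspaceI) (auto simp: vanishes_from_def ell2_nth_simps)

lemma vanishes_from_mono: "j \<le> k \<Longrightarrow> vanishes_from j \<subseteq> vanishes_from k"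
  by (auto simp: vanishes_from_def)

lemma shiftL_vanishes_from: "x \<in> vanishes_from k \<Longrightarrow> shiftL x \<in> vanishes_from k"
  by (auto simp: vanishes_from_def ell2_nth_simps)

lemma shiftR_vanishes_from: "x \<in> vanishes_from k \<Longrightarrow> shiftR x \<in> vanishes_from (Suc k)"
  by (auto simp: vanishes_from_def ell2_nth_simps split: nat.split)

lemma unit0_vanishes_from: "unit0 \<in> vanishes_from (Suc k)"
  by (simp add: vanishes_from_def ell2_nth_simps)

text \<open>
  The geometric sequence is an eigenvector of the left shift, and \<open>k\<close> left shifts erase \<open>x\<close>.  As the
  left shift is a contraction, what survives of the difference bounds it from below.
\<close>

lemma geometric_tail_bound:
  assumes "\<bar>q\<bar> < 1" and "x \<in> vanishes_from k"
  shows "\<bar>q\<bar> ^ k * norm (geometric q) \<le> norm (x - geometric q)"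
proof -
  have "(shiftL ^^ k) (x - geometric q) = - (q ^ k *\<^sub>R geometric q)"
    by (rule ell2_eqI)
      (use assms in \<open>simp add: ell2_nth_funpow_shiftL ell2_nth_simps vanishes_from_def power_add\<close>)
  with norm_funpow_shiftL_le[of k "x - geometric q"] show ?thesis
    by (simp add: power_abs)
qed

text \<open>
  Sequences of a fixed finite support form a subspace.  So the next query point, a combination of the
  gradients seen so far, has no more coordinates than the longest of these gradients.
\<close>

lemma query_vanishes_from:
  assumes extends: "\<And>k x. x \<in> vanishes_from k \<Longrightarrow> grad f x \<in> vanishes_from (Suc k)"
    and span: "span_condition A f"
  shows "query A f (Suc s) \<in> vanishes_from s"
proof (induction s rule: less_induct)
  case (less s)
  show ?case
  proof (cases s)
    case 0
    then show ?thesis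
      using span by (simp add: span_condition_def vanishes_from_def ell2_nth_simps)
  next
    case (Suc r)
    have "grad f (query A f j) \<in> vanishes_from s" if j: "j \<in> {1..s}" for j
    proof -
      from j obtain i where i: "j = Suc i" "i < s"
        by (cases j) auto
      from less[OF i(2)] have "grad f (query A f j) \<in> vanishes_from (Suc i)"
        unfolding i(1) by (rule extends)
      with vanishes_from_mono[of "Suc i" s] i(2) show ?thesis
        by auto
    qed
    then have "span ((\<lambda>j. grad f (query A f j)) ` {1..s}) \<subseteq> vanishes_from s"
      by (intro span_minimal subspace_vanishes_from) auto
    moreover have "query A f (s + 1) \<in> span ((\<lambda>j. grad f (query A f j)) ` {1..s})"
      using span Suc unfolding span_condition_def by simp
    ultimately show ?thesis
      by auto
  qed
qed

section \<open>Quadratic functions on an inner product space\<close>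

definition quadratic :: "('a::real_inner \<Rightarrow> 'a) \<Rightarrow> 'a \<Rightarrow> 'a \<Rightarrow> real" where
  "quadratic M b x = inner (M x) x / 2 - inner b x"

lemma GDERIV_quadratic:
  assumes "bounded_linear M" and sym: "\<And>x y. inner (M x) y = inner x (M y)"
  shows "GDERIV (quadratic M b) x :> M x - b"
proof -
  have M: "(M has_derivative M) (at x)"
    by (rule bounded_linear_imp_has_derivative[OF assms(1)])
  have "((\<lambda>x. inner (M x) x / 2 - inner b x) has_derivative
      (\<lambda>h. (inner (M x) h + inner (M h) x) / 2 - inner b h)) (at x)"
    by (auto intro!: derivative_eq_intros M)
  moreover have "(inner (M x) h + inner (M h) x) / 2 - inner b h = inner h (M x - b)" for h
    using sym[of h x] by (simp add: inner_diff_right inner_commute)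
  ultimately show ?thesis
    by (simp add: gderiv_def quadratic_def[abs_def])
qed

lemma grad_quadratic:
  assumes "bounded_linear M" and "\<And>x y. inner (M x) y = inner x (M y)"
  shows "grad (quadratic M b) x = M x - b"
  by (rule grad_eqI[OF GDERIV_quadratic[OF assms]])

lemma smooth_fun_quadratic:
  assumes M: "bounded_linear M" "\<And>x y. inner (M x) y = inner x (M y)"
    and bound: "\<And>x. norm (M x) \<le> \<beta> * norm x"
  shows "smooth_fun \<beta> (quadratic M b)"
proof -
  have grad: "grad (quadratic M b) = (\<lambda>x. M x - b)"
    using grad_quadratic[OF M] by (rule ext)
  show ?thesis
    unfolding smooth_fun_def grad
  proof (intro conjI allI)
    show "GDERIV (quadratic M b) x :> M x - b" for x
      by (rule GDERIV_quadratic[OF M])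
    show "continuous_on UNIV (\<lambda>x. M x - b)"
      by (intro continuous_intros bounded_linear.continuous_on[OF M(1)])
    show "norm (M x - b - (M y - b)) \<le> \<beta> * norm (x - y)" for x y
      using bound[of "x - y"] by (simp add: bounded_linear.linear[OF M(1)] linear_diff)
  qed
qed

lemma strongly_convex_fun_quadratic:
  assumes M: "bounded_linear M" "\<And>x y. inner (M x) y = inner x (M y)"
    and coercive: "\<And>x. \<alpha> * (norm x)\<^sup>2 \<le> inner (M x) x" and "\<alpha> > 0"
  shows "strongly_convex_fun \<alpha> (quadratic M b)"
  unfolding strongly_convex_fun_def
proof (intro conjI allI)
  fix x y
  have "quadratic M b x - quadratic M b y
      = inner (M x - b) (x - y) - inner (M (x - y)) (x - y) / 2"
    using M(2)[of y x]
    by (simp add: quadratic_def linear_diff[OF bounded_linear.linear[OF M(1)]]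
        inner_diff_left inner_diff_right inner_commute field_simps)
  with coercive[of "x - y"]
  show "quadratic M b x - quadratic M b y
      \<le> inner (grad (quadratic M b) x) (x - y) - \<alpha> / 2 * (norm (x - y))\<^sup>2"
    by (simp add: grad_quadratic[OF M])
qed fact

lemma strongly_convex_gap:
  assumes "strongly_convex_fun \<alpha> f" and "grad f z = 0"
  shows "\<alpha> / 2 * (norm (x - z))\<^sup>2 \<le> f x - f z"
proof -
  from assms have "f z - f x \<le> - (\<alpha> / 2 * (norm (z - x))\<^sup>2)"
    unfolding strongly_convex_fun_def by (metis diff_0 inner_zero_left)
  then show ?thesis
    by (simp add: norm_minus_commute)
qed

section \<open>The tridiagonal operator\<close>

definition tridiag :: "real \<Rightarrow> real \<Rightarrow> ell2 \<Rightarrow> ell2" where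
  "tridiag \<alpha> c x = \<alpha> *\<^sub>R x + c *\<^sub>R (x + x - shiftR x - shiftL x)"

lemma norm_tridiag_le:
  assumes "0 \<le> \<alpha>" "0 \<le> c"
  shows "norm (tridiag \<alpha> c x) \<le> (\<alpha> + 4 * c) * norm x"
proof -
  have "norm (x + x - shiftR x - shiftL x) \<le> norm (x + x) + norm (shiftR x) + norm (shiftL x)"
    by (rule order_trans[OF norm_triangle_ineq4 add_right_mono[OF norm_triangle_ineq4]])
  also have "\<dots> \<le> 4 * norm x"
    using norm_triangle_ineq[of x x] norm_shiftL_le[of x] by simp
  finally have *: "norm (x + x - shiftR x - shiftL x) \<le> 4 * norm x" .
  have "norm (tridiag \<alpha> c x) \<le> \<alpha> * norm x + c * norm (x + x - shiftR x - shiftL x)"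
    unfolding tridiag_def using assms by (auto intro: order_trans[OF norm_triangle_ineq])
  also have "\<dots> \<le> \<alpha> * norm x + c * (4 * norm x)"
    using * assms by (intro add_left_mono mult_left_mono)
  finally show ?thesis
    by (simp add: algebra_simps)
qed

lemma linear_tridiag: "linear (tridiag \<alpha> c)"
  by (rule linearI)
    (simp_all add: tridiag_def linear_add[OF linear_shiftL] linear_add[OF linear_shiftR]
      linear_scale[OF linear_shiftL] linear_scale[OF linear_shiftR] algebra_simps)

lemma bounded_linear_tridiag:
  assumes "0 \<le> \<alpha>" "0 \<le> c"
  shows "bounded_linear (tridiag \<alpha> c)"
  using linear_tridiag norm_tridiag_le[OF assms]
  by (intro bounded_linear_intro[where K = "\<alpha> + 4 * c"])
    (simp_all add: linear_add linear_scale mult.commute)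

lemma tridiag_symmetric: "inner (tridiag \<alpha> c x) y = inner x (tridiag \<alpha> c y)"
  by (simp add: tridiag_def inner_add_left inner_add_right inner_diff_left inner_diff_right
      inner_shiftR_left inner_shiftL_left algebra_simps)

text \<open>
  The operator \<open>2 I - S - L\<close> is positive: both \<open>\<langle>S x, x\<rangle>\<close> and \<open>\<langle>L x, x\<rangle>\<close> are at most \<open>\<parallel>x\<parallel>\<^sup>2\<close>
  by the Cauchy-Schwarz inequality, since the shifts are contractions.
\<close>

lemma tridiag_coercive:
  assumes "0 \<le> c"
  shows "\<alpha> * (norm x)\<^sup>2 \<le> inner (tridiag \<alpha> c x) x"
proof -
  have R: "inner (shiftR x) x \<le> (norm x)\<^sup>2"
    using norm_cauchy_schwarz[of "shiftR x" x] by (simp add: power2_eq_square)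
  then have L: "inner (shiftL x) x \<le> (norm x)\<^sup>2"
    by (metis inner_commute inner_shiftL_left)
  have "0 \<le> c * (2 * (norm x)\<^sup>2 - inner (shiftR x) x - inner (shiftL x) x)"
    using assms R L by simp
  also have "\<dots> = inner (tridiag \<alpha> c x) x - \<alpha> * (norm x)\<^sup>2"
    by (simp add: tridiag_def inner_add_left inner_diff_left power2_norm_eq_inner algebra_simps)
  finally show ?thesis
    by simp
qed

text \<open>
  The hypothesis is the characteristic equation of the recurrence.  The inhomogeneity
  \<open>c *\<^sub>R unit0\<close> supplies in row \<open>0\<close> the missing left neighbour \<open>q ^ 0 = 1\<close> of the first entry
  \<open>q\<close>, so that this row gives the same equation as all the others.
\<close>

lemma tridiag_geometric:
  assumes q: "\<bar>q\<bar> < 1" and char_eq: "(\<alpha> + 2 * c) * q = c * (q\<^sup>2 + 1)"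
  shows "tridiag \<alpha> c (geometric q) = c *\<^sub>R unit0"
proof (rule ell2_eqI)
  fix n
  have "\<alpha> * q ^ Suc n + c * (2 * q ^ Suc n - q ^ n - q ^ Suc (Suc n)) =
      q ^ n * ((\<alpha> + 2 * c) * q - c * (q\<^sup>2 + 1))"
    by (simp add: algebra_simps power2_eq_square)
  then have "\<alpha> * q ^ Suc n + c * (2 * q ^ Suc n - q ^ n - q ^ Suc (Suc n)) = 0"
    using char_eq by simp
  then show "ell2_nth (tridiag \<alpha> c (geometric q)) n = ell2_nth (c *\<^sub>R unit0) n"
    using q by (cases n) (simp_all add: tridiag_def ell2_nth_simps algebra_simps)
qed

lemma tridiag_vanishes_from:
  assumes "x \<in> vanishes_from k"
  shows "tridiag \<alpha> c x \<in> vanishes_from (Suc k)"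
proof -
  note sub = subspace_vanishes_from[of "Suc k"]
  have "x \<in> vanishes_from (Suc k)" "shiftL x \<in> vanishes_from (Suc k)"
    using assms shiftL_vanishes_from[OF assms] vanishes_from_mono[of k "Suc k"] by auto
  with shiftR_vanishes_from[OF assms] show ?thesis
    unfolding tridiag_def
    by (intro subspace_add[OF sub] subspace_diff[OF sub] subspace_scale[OF sub])
qed

section \<open>The lower bound\<close>

theorem theorem3p15:
  fixes \<kappa> \<alpha> \<beta> :: real
  assumes "\<kappa> > 1" and "\<alpha> > 0" and "\<kappa> = \<beta> / \<alpha>"
  shows "\<exists>(f :: ell2 \<Rightarrow> real) xstar.
    smooth_fun \<beta> f \<and> strongly_convex_fun \<alpha> f \<and>
    is_arg_min f (\<lambda>_. True) xstar \<and>
    (\<forall>(t :: nat) (A :: ell2 black_box). t \<ge> 1 \<longrightarrow> span_condition A f \<longrightarrow>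
       f (query A f t) - f xstar \<ge>
         \<alpha> / 2 * ((sqrt \<kappa> - 1) / (sqrt \<kappa> + 1)) ^ (2 * (t - 1)) *
           (norm (query A f 1 - xstar))\<^sup>2)"
proof -
  define r where "r = sqrt \<kappa>"
  define q where "q = (r - 1) / (r + 1)"
  define c where "c = \<alpha> * (r\<^sup>2 - 1) / 4"
  define M where "M = tridiag \<alpha> c"
  define f where "f = quadratic M (c *\<^sub>R unit0)"
  define xstar where "xstar = geometric q"
  have r: "r > 1" and r2: "r\<^sup>2 = \<kappa>"
    using assms(1) by (simp_all add: r_def)
  have q: "0 \<le> q" "q < 1"
    using r by (simp_all add: q_def)
  have c: "c \<ge> 0"
    using assms r2 by (simp add: c_def)
  have \<beta>: "\<alpha> + 4 * c = \<beta>"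
    using assms r2 by (simp add: c_def field_simps)
  have char_eq: "(\<alpha> + 2 * c) * q = c * (q\<^sup>2 + 1)"
  proof -
    \<comment> \<open>Substituting \<open>r - 1 = q (r + 1)\<close> turns the right-hand side into \<open>\<alpha> q (r\<^sup>2 + 1) / 2\<close>.\<close>
    have qr: "q * (r + 1) = r - 1"
      using r by (simp add: q_def)
    have "(r\<^sup>2 - 1) * (q\<^sup>2 + 1) = (r - 1) * (q * (q * (r + 1))) + (r - 1) * (r + 1)"
      by (simp add: algebra_simps power2_eq_square)
    also have "\<dots> = (q * (r + 1)) * (q * (r - 1)) + (q * (r + 1)) * (r + 1)"
      by (simp only: qr)
    also have "\<dots> = q * ((r - 1) * (q * (r + 1)) + (r + 1) * (r + 1))"
      by (simp add: algebra_simps)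
    also have "\<dots> = 2 * q * (r\<^sup>2 + 1)"
      by (simp only: qr) (simp add: algebra_simps power2_eq_square)
    finally have "c * (q\<^sup>2 + 1) = \<alpha> / 4 * (2 * q * (r\<^sup>2 + 1))"
      by (simp add: c_def)
    also have "\<dots> = (\<alpha> + 2 * c) * q"
      by (simp add: c_def field_simps)
    finally show ?thesis
      by simp
  qed
  have M: "bounded_linear M" "\<And>x y. inner (M x) y = inner x (M y)"
    using assms(2) c by (simp_all add: M_def bounded_linear_tridiag tridiag_symmetric)
  have grad: "grad f x = M x - c *\<^sub>R unit0" for x
    unfolding f_def by (rule grad_quadratic[OF M])
  have smooth: "smooth_fun \<beta> f"
    unfolding f_def
    by (rule smooth_fun_quadratic[OF M])
      (use norm_tridiag_le[of \<alpha> c] assms(2) c \<beta> in \<open>simp add: M_def\<close>)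
  have convex: "strongly_convex_fun \<alpha> f"
    unfolding f_def
    by (rule strongly_convex_fun_quadratic[OF M])
      (use tridiag_coercive[OF c] assms(2) in \<open>simp_all add: M_def\<close>)
  have "grad f xstar = 0"
    using tridiag_geometric[OF _ char_eq] q by (simp add: grad M_def xstar_def)
  note gap = strongly_convex_gap[OF convex this]
  have "f xstar \<le> f x" for x
  proof -
    have "0 \<le> \<alpha> / 2 * (norm (x - xstar))\<^sup>2"
      using assms(2) by simp
    with gap[of x] show ?thesis
      by linarith
  qed
  then have minimizer: "is_arg_min f (\<lambda>_. True) xstar"
    by (simp add: is_arg_min_linorder)
  have extends: "grad f x \<in> vanishes_from (Suc k)" if "x \<in> vanishes_from k" for k x
    unfolding grad M_def
    by (intro subspace_diff[OF subspace_vanishes_from] subspace_scale[OF subspace_vanishes_from]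
        tridiag_vanishes_from[OF that] unit0_vanishes_from)
  have "\<alpha> / 2 * q ^ (2 * (t - 1)) * (norm (query A f 1 - xstar))\<^sup>2 \<le> f (query A f t) - f xstar"
    if t: "t \<ge> 1" and span: "span_condition A f" for t A
  proof -
    have "query A f t \<in> vanishes_from (t - 1)"
      using query_vanishes_from[OF extends span, of "t - 1"] t by simp
    then have "q ^ (t - 1) * norm xstar \<le> norm (query A f t - xstar)"
      using geometric_tail_bound[of q "query A f t" "t - 1"] q by (simp add: xstar_def)
    then have "(q ^ (t - 1) * norm xstar)\<^sup>2 \<le> (norm (query A f t - xstar))\<^sup>2"
      using q by (intro power_mono) simp_all
    then have "\<alpha> / 2 * (q ^ (t - 1) * norm xstar)\<^sup>2 \<le> \<alpha> / 2 * (norm (query A f t - xstar))\<^sup>2"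
      using assms(2) by (intro mult_left_mono) simp_all
    also note gap
    finally have "\<alpha> / 2 * (q ^ (t - 1) * norm xstar)\<^sup>2 \<le> f (query A f t) - f xstar" .
    moreover have "query A f 1 = 0"
      using span by (simp add: span_condition_def)
    ultimately show ?thesis
      by (simp add: power_mult_distrib power_mult[symmetric] mult.commute mult.left_commute)
  qed
  with smooth convex minimizer show ?thesis
    unfolding q_def r_def by blast
qed

end
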